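(* Let $B\ge 1$, let $x_{\rm tr}\in\mathbb{C}^B\setminus\{0\}$ be a fixed training vector, let $\sigma_x^2,\sigma_w^2>0$, and let $h\in\mathbb{C}$ be a deterministic (unknown) channel coefficient. Then the minimum variance unbiased (MVU) estimating filter $f_{\rm MVU}=x_{\rm tr}/\|x_{\rm tr}\|^2$ is not an optimal channel estimator for the task of minimizing the zeroth order symbol estimate MSE of the zero-forcing equalizer; that is, $f_{\rm MVU}$ does not minimize $f\mapsto \left[\mathrm{MSE}_x^{dc}(\mathrm{ZF})\right]_0(f)$ over $f\in\mathbb{C}^B\setminus\{0\}$.
   Context: Training model: $y_{\rm tr}=h\,x_{\rm tr}+w_{\rm tr}$, where $w_{\rm tr}\in\mathbb{C}^B$ has i.i.d. circularly symmetric complex Gaussian entries of mean $0$ and variance $\sigma_w^2$. A linear channel estimator is determined by a filter $f\in\mathbb{C}^B$ through $\hat h=f^H y_{\rm tr}$. The data symbols have mean zero and power $\sigma_x^2$. The zeroth order symbol estimate MSE for a deterministic channel is defined as $$\left[\mathrm{MSE}_x^{dc}(\mathrm{ZF})\right]_0(f)=\frac{E[|\hat h-h|^2]}{E[|\hat h|^2]}\,\sigma_x^2+\frac{\sigma_w^2}{E[|\hat h|^2]} =\sigma_x^2\,\frac{|h|^2|f^Hx_{\rm tr}-1|^2+\sigma_w^2\|f\|^2+\sigma_w^2/\sigma_x^2}{|h|^2|f^Hx_{\rm tr}|^2+\sigma_w^2\|f\|^2},$$ with expectations over $w_{\rm tr}$ ($h$ is fixed). *)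

theory Defs
  imports "HOL-Probability.Probability"
begin

definition herm_prod :: "complex ^ 'b \<Rightarrow> complex ^ 'b \<Rightarrow> complex" where
  "herm_prod f y = (\<Sum>i\<in>UNIV. cnj (f $ i) * y $ i)"

text \<open>The law \<open>CN(0, v)\<close>: the real and imaginary parts are independent
  \<open>N(0, v/2)\<close>, so that \<open>E[|Z|^2] = v\<close>. The second argument of
  \<open>normal_density\<close> is a standard deviation.\<close>

definition circ_gaussian :: "'a measure \<Rightarrow> real \<Rightarrow> ('a \<Rightarrow> complex) \<Rightarrow> bool" where
  "circ_gaussian M v Z \<longleftrightarrow>
     distributed M lborel (\<lambda>\<omega>. Re (Z \<omega>)) (normal_density 0 (sqrt (v / 2))) \<and>
     distributed M lborel (\<lambda>\<omega>. Im (Z \<omega>)) (normal_density 0 (sqrt (v / 2))) \<and>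
     prob_space.indep_var M borel (\<lambda>\<omega>. Re (Z \<omega>)) borel (\<lambda>\<omega>. Im (Z \<omega>))"

definition iid_circ_gaussian :: "'a measure \<Rightarrow> real \<Rightarrow> ('a \<Rightarrow> complex ^ 'b) \<Rightarrow> bool" where
  "iid_circ_gaussian M v w \<longleftrightarrow>
     prob_space.indep_vars M (\<lambda>_. borel) (\<lambda>i \<omega>. w \<omega> $ i) UNIV \<and>
     (\<forall>i. circ_gaussian M v (\<lambda>\<omega>. w \<omega> $ i))"

definition training_output ::
    "complex \<Rightarrow> complex ^ 'b \<Rightarrow> ('a \<Rightarrow> complex ^ 'b) \<Rightarrow> 'a \<Rightarrow> complex ^ 'b" where
  "training_output h x w \<omega> = h *s x + w \<omega>"

definition channel_estimate ::
    "complex \<Rightarrow> complex ^ 'b \<Rightarrow> ('a \<Rightarrow> complex ^ 'b) \<Rightarrow> complex ^ 'b \<Rightarrow> 'a \<Rightarrow> complex" where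
  "channel_estimate h x w f \<omega> = herm_prod f (training_output h x w \<omega>)"

text \<open>Here \<open>vx\<close> is the data symbol power \<open>\<sigma>\<^sub>x\<^sup>2\<close> and \<open>vw\<close> the noise
  variance \<open>\<sigma>\<^sub>w\<^sup>2\<close>.\<close>

definition zf_mse0 ::
    "'a measure \<Rightarrow> complex \<Rightarrow> complex ^ 'b \<Rightarrow> ('a \<Rightarrow> complex ^ 'b) \<Rightarrow> real \<Rightarrow> real
      \<Rightarrow> complex ^ 'b \<Rightarrow> real" where
  "zf_mse0 M h x w vx vw f =
     (let est = channel_estimate h x w f in
       (LINT \<omega>|M. (cmod (est \<omega> - h))\<^sup>2) / (LINT \<omega>|M. (cmod (est \<omega>))\<^sup>2) * vx
       + vw / (LINT \<omega>|M. (cmod (est \<omega>))\<^sup>2))"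

definition mvu_filter :: "complex ^ 'b \<Rightarrow> complex ^ 'b" where
  "mvu_filter x = x /\<^sub>R (norm x)\<^sup>2"

end

theory Submission
  imports Defs
begin

text \<open>Restrict to the ray of filters \<open>t f\<close> with \<open>t > 0\<close> and \<open>f\<close> the MVU filter. In terms of
  \<open>u = 1 / t\<close>, the objective is a positive constant times \<open>|h|\<^sup>2 (1 - u)\<^sup>2 + (v\<^sub>w / v\<^sub>x) u\<^sup>2\<close>, up to
  an additive constant. At the MVU filter, \<open>u = 1\<close>, its derivative in \<open>u\<close> is proportional to
  \<open>2 v\<^sub>w / v\<^sub>x > 0\<close>, so enlarging the filter slightly strictly decreases the objective.\<close>

text \<open>The form \<open>has_bochner_integral\<close> packs integrability together with the
  value, so that later moments can be assembled by introduction rules alone.\<close>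

lemma (in prob_space) centered_normal_moments:
  assumes "0 < \<sigma>" and D: "distributed M lborel X (normal_density 0 \<sigma>)"
  shows "has_bochner_integral M X 0"
    and "has_bochner_integral M (\<lambda>\<omega>. (X \<omega>)\<^sup>2) (\<sigma>\<^sup>2)"
proof -
  have E: "expectation X = 0"
    by (rule normal_distributed_expectation[OF assms])
  have "integrable M X"
    using distributed_integrable[OF D, of "\<lambda>x. x"] integrable_normal_moment_nz_1[OF \<open>0 < \<sigma>\<close>, of 0]
    by simp
  with E show "has_bochner_integral M X 0"
    by (simp add: has_bochner_integral_iff)
  have "integrable M (\<lambda>\<omega>. (X \<omega>)\<^sup>2)"
    using distributed_integrable[OF D, of "\<lambda>x. x\<^sup>2"] integrable_normal_moment[OF \<open>0 < \<sigma>\<close>, of 0 2]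
    by simp
  moreover have "expectation (\<lambda>\<omega>. (X \<omega>)\<^sup>2) = \<sigma>\<^sup>2"
    using normal_distributed_variance[OF assms] E by simp
  ultimately show "has_bochner_integral M (\<lambda>\<omega>. (X \<omega>)\<^sup>2) (\<sigma>\<^sup>2)"
    by (simp add: has_bochner_integral_iff)
qed

text \<open>Real and imaginary part contribute variance \<open>v / 2\<close> each. The second moment
  is phrased as \<open>Z * cnj Z\<close> over the complex numbers so that it can serve as the
  diagonal of a covariance matrix.\<close>

lemma (in prob_space) circ_gaussian_moments:
  assumes "0 < v" and "circ_gaussian M v Z"
  shows "has_bochner_integral M Z 0"
    and "has_bochner_integral M (\<lambda>\<omega>. Z \<omega> * cnj (Z \<omega>)) (of_real v)"
proof -
  have s: "0 < sqrt (v / 2)" "(sqrt (v / 2))\<^sup>2 = v / 2"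
    using \<open>0 < v\<close> by simp_all
  note Re = centered_normal_moments[OF s(1), of "\<lambda>\<omega>. Re (Z \<omega>)"]
  note Im = centered_normal_moments[OF s(1), of "\<lambda>\<omega>. Im (Z \<omega>)"]
  have D: "distributed M lborel (\<lambda>\<omega>. Re (Z \<omega>)) (normal_density 0 (sqrt (v / 2)))"
    "distributed M lborel (\<lambda>\<omega>. Im (Z \<omega>)) (normal_density 0 (sqrt (v / 2)))"
    using assms(2) by (simp_all add: circ_gaussian_def)
  have "has_bochner_integral M (\<lambda>\<omega>. of_real (Re (Z \<omega>)) + \<i> * of_real (Im (Z \<omega>)))
      (of_real 0 + \<i> * of_real 0)"
    by (intro has_bochner_integral_add has_bochner_integral_mult_right
        has_bochner_integral_of_real Re(1) Im(1) D)
  then show "has_bochner_integral M Z 0"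
    by (simp add: complex_eq[symmetric])
  have "has_bochner_integral M (\<lambda>\<omega>. of_real ((Re (Z \<omega>))\<^sup>2 + (Im (Z \<omega>))\<^sup>2) :: complex)
      (of_real (v / 2 + v / 2))"
    using Re(2)[OF D(1)] Im(2)[OF D(2)] unfolding s(2)
    by (intro has_bochner_integral_of_real has_bochner_integral_add)
  then show "has_bochner_integral M (\<lambda>\<omega>. Z \<omega> * cnj (Z \<omega>)) (of_real v)"
    by (simp add: complex_mult_cnj)
qed

text \<open>Supplies the off-diagonal covariances. Conjugation is Borel measurable, so conjugating
  one factor preserves independence, and the expectation of the product splits.\<close>

lemma (in prob_space) indep_vars_mult_cnj:
  fixes X :: "'i \<Rightarrow> 'a \<Rightarrow> complex"
  assumes indep: "indep_vars (\<lambda>_. borel) X I" and ij: "i \<in> I" "j \<in> I" "i \<noteq> j"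
    and "has_bochner_integral M (X i) a" "has_bochner_integral M (X j) b"
  shows "has_bochner_integral M (\<lambda>\<omega>. X i \<omega> * cnj (X j \<omega>)) (a * cnj b)"
proof -
  \<comment> \<open>The product rule is available for indexed families, so the choice of which
    factor to conjugate is encoded in the index.\<close>
  define Y :: "'i \<Rightarrow> complex \<Rightarrow> complex" where "Y k = (if k = i then (\<lambda>z. z) else cnj)" for k
  have [measurable]: "cnj \<in> borel_measurable borel"
    by (intro borel_measurable_continuous_onI continuous_intros)
  have ind: "indep_vars (\<lambda>_. borel) (\<lambda>k \<omega>. Y k (X k \<omega>)) {i, j}"
    using ij by (intro indep_vars_compose2[OF indep_vars_subset[OF indep]]) (auto simp: Y_def)
  have int: "integrable M (\<lambda>\<omega>. Y k (X k \<omega>))" if "k \<in> {i, j}" for k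
    using that assms by (auto simp: Y_def has_bochner_integral_iff)
  have "integrable M (\<lambda>\<omega>. \<Prod>k\<in>{i, j}. Y k (X k \<omega>))"
    "(\<integral>\<omega>. (\<Prod>k\<in>{i, j}. Y k (X k \<omega>)) \<partial>M) = (\<Prod>k\<in>{i, j}. \<integral>\<omega>. Y k (X k \<omega>) \<partial>M)"
    using indep_vars_integrable[OF _ ind int] indep_vars_lebesgue_integral[OF _ ind int] by auto
  then show ?thesis
    using assms by (simp add: Y_def has_bochner_integral_iff)
qed

text \<open>Filtered noise has mean zero, which removes the cross terms with \<open>c\<close>; its
  covariance is \<open>v\<close> times the identity, which leaves the filter energy scaled by
  \<open>v\<close>. Numerator and denominator of the objective are both of this kind.\<close>

lemma (in prob_space) expectation_cmod_square_affine:
  fixes w :: "'a \<Rightarrow> complex ^ 'b"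
  assumes "0 < v" and "iid_circ_gaussian M v w"
  shows "expectation (\<lambda>\<omega>. (cmod (c + herm_prod f (w \<omega>)))\<^sup>2) = (cmod c)\<^sup>2 + v * (norm f)\<^sup>2"
proof -
  define S where "S \<omega> = herm_prod f (w \<omega>)" for \<omega>
  have ind: "indep_vars (\<lambda>_. borel) (\<lambda>i \<omega>. w \<omega> $ i) UNIV"
    using assms by (simp add: iid_circ_gaussian_def)
  have cg: "circ_gaussian M v (\<lambda>\<omega>. w \<omega> $ i)" for i
    using assms by (simp add: iid_circ_gaussian_def)
  note mom = circ_gaussian_moments[OF \<open>0 < v\<close> cg]
  \<comment> \<open>The noise is white: for distinct entries the expectation is a product of two
    zero means.\<close>
  have corr: "has_bochner_integral M (\<lambda>\<omega>. w \<omega> $ i * cnj (w \<omega> $ j)) (if i = j then of_real v else 0)"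
    for i j
    using mom(2)[of i] indep_vars_mult_cnj[OF ind, of i j, OF _ _ _ mom(1) mom(1)] by auto
  have "has_bochner_integral M (\<lambda>\<omega>. \<Sum>i\<in>UNIV. cnj (f $ i) * w \<omega> $ i) (\<Sum>i\<in>UNIV. cnj (f $ i) * 0)"
    by (intro has_bochner_integral_sum has_bochner_integral_mult_right mom(1))
  then have S1: "has_bochner_integral M S 0"
    by (simp add: S_def[abs_def] herm_prod_def)
  \<comment> \<open>Expand the squared modulus of \<open>S\<close> as a double sum; taking
    expectations leaves only the diagonal.\<close>
  have "has_bochner_integral M
      (\<lambda>\<omega>. \<Sum>i\<in>UNIV. \<Sum>j\<in>UNIV. (cnj (f $ i) * f $ j) * (w \<omega> $ i * cnj (w \<omega> $ j)))
      (\<Sum>i\<in>UNIV. \<Sum>j\<in>UNIV. (cnj (f $ i) * f $ j) * (if i = j then of_real v else 0))"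
    by (intro has_bochner_integral_sum has_bochner_integral_mult_right corr)
  also have "(\<lambda>\<omega>. \<Sum>i\<in>UNIV. \<Sum>j\<in>UNIV. (cnj (f $ i) * f $ j) * (w \<omega> $ i * cnj (w \<omega> $ j)))
      = (\<lambda>\<omega>. S \<omega> * cnj (S \<omega>))"
    by (simp add: S_def herm_prod_def sum_product) (simp add: mult_ac)
  also have "(\<Sum>i\<in>UNIV. \<Sum>j\<in>UNIV. (cnj (f $ i) * f $ j) * (if i = j then of_real v else 0))
      = (\<Sum>i\<in>UNIV. of_real v * of_real ((cmod (f $ i))\<^sup>2))"
    by (simp add: if_distrib[of "\<lambda>x. _ * x"] sum.delta complex_norm_square mult_ac
        del: of_real_power cong: if_cong)
  also have "\<dots> = of_real (v * (norm f)\<^sup>2)"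
    by (simp add: norm_vec_def L2_set_def sum_nonneg sum_distrib_left)
  finally have S2: "has_bochner_integral M (\<lambda>\<omega>. S \<omega> * cnj (S \<omega>)) (of_real (v * (norm f)\<^sup>2))" .
  \<comment> \<open>The square is expanded over the complex numbers, where it is a product with the
    conjugate; the result is read back as a real identity at the end.\<close>
  have "has_bochner_integral M (\<lambda>\<omega>. c * cnj c + c * cnj (S \<omega>) + cnj c * S \<omega> + S \<omega> * cnj (S \<omega>))
      (c * cnj c + c * cnj 0 + cnj c * 0 + of_real (v * (norm f)\<^sup>2))"
    by (intro has_bochner_integral_add has_bochner_integral_mult_right has_bochner_integral_cnj S1 S2)
      (simp add: has_bochner_integral_iff prob_space)
  also have "(\<lambda>\<omega>. c * cnj c + c * cnj (S \<omega>) + cnj c * S \<omega> + S \<omega> * cnj (S \<omega>))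
      = (\<lambda>\<omega>. complex_of_real ((cmod (c + S \<omega>))\<^sup>2))"
    by (simp only: complex_norm_square complex_cnj_add) (simp add: algebra_simps)
  also have "c * cnj c + c * cnj 0 + cnj c * 0 + of_real (v * (norm f)\<^sup>2)
      = complex_of_real ((cmod c)\<^sup>2 + v * (norm f)\<^sup>2)"
    by (simp add: complex_norm_square del: of_real_power)
  finally have "(\<integral>\<omega>. complex_of_real ((cmod (c + S \<omega>))\<^sup>2) \<partial>M)
      = complex_of_real ((cmod c)\<^sup>2 + v * (norm f)\<^sup>2)"
    by (rule has_bochner_integral_integral_eq)
  then show ?thesis
    unfolding S_def integral_complex_of_real of_real_eq_iff .
qed

lemma channel_estimate_eq:
  "channel_estimate h x w f \<omega> = h * herm_prod f x + herm_prod f (w \<omega>)"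
  by (simp add: channel_estimate_def training_output_def herm_prod_def algebra_simps
      sum.distrib sum_distrib_left)

lemma (in prob_space) zf_mse0_eq:
  assumes "0 < vw" and "iid_circ_gaussian M vw w"
  shows "zf_mse0 M h x w vx vw f =
    ((cmod h)\<^sup>2 * (cmod (herm_prod f x - 1))\<^sup>2 + vw * (norm f)\<^sup>2)
        / ((cmod h)\<^sup>2 * (cmod (herm_prod f x))\<^sup>2 + vw * (norm f)\<^sup>2) * vx
      + vw / ((cmod h)\<^sup>2 * (cmod (herm_prod f x))\<^sup>2 + vw * (norm f)\<^sup>2)"
proof -
  \<comment> \<open>The estimation error is again a constant plus filtered noise, now with bias
    \<open>h * (herm_prod f x - 1)\<close>.\<close>
  have "channel_estimate h x w f \<omega> - h = h * (herm_prod f x - 1) + herm_prod f (w \<omega>)" for \<omega>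
    by (simp add: channel_estimate_eq algebra_simps)
  then show ?thesis
    by (simp add: zf_mse0_def Let_def)
      (simp add: channel_estimate_eq expectation_cmod_square_affine[OF assms]
        norm_mult power_mult_distrib)
qed

lemma herm_prod_scaled_self: "herm_prod (r *\<^sub>R x) x = of_real (r * (norm x)\<^sup>2)"
proof -
  have "herm_prod (r *\<^sub>R x) x = of_real r * (\<Sum>i\<in>UNIV. of_real ((cmod (x $ i))\<^sup>2))"
    by (simp add: herm_prod_def complex_norm_square sum_distrib_left
        scaleR_conv_of_real[where 'a = complex] mult_ac del: of_real_power)
  then show ?thesis
    by (simp add: norm_vec_def L2_set_def sum_nonneg)
qed

text \<open>Every squared modulus and the filter energy carry a factor \<open>1 / u^2\<close>, which
  cancels in the quotient. Only the isolated \<open>vw\<close> lacks it and so acquires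
  \<open>u^2\<close>. What remains is quadratic in \<open>u\<close> over a denominator free of
  \<open>u\<close>.\<close>

lemma (in prob_space) zf_mse0_scaled_mvu_filter:
  assumes "0 < vw" and "iid_circ_gaussian M vw w" and "x \<noteq> 0" and "0 < u"
  shows "zf_mse0 M h x w vx vw (mvu_filter x /\<^sub>R u) =
    (((cmod h)\<^sup>2 * (1 - u)\<^sup>2 + vw / (norm x)\<^sup>2) * vx + vw * u\<^sup>2) / ((cmod h)\<^sup>2 + vw / (norm x)\<^sup>2)"
proof -
  define n where "n = (norm x)\<^sup>2"
  have "0 < n"
    using \<open>x \<noteq> 0\<close> by (simp add: n_def)
  have f: "mvu_filter x /\<^sub>R u = (1 / (u * n)) *\<^sub>R x"
    by (simp add: mvu_filter_def n_def field_simps)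
  have hp: "herm_prod (mvu_filter x /\<^sub>R u) x = of_real (1 / u)"
    unfolding f herm_prod_scaled_self using \<open>0 < n\<close> by (simp add: n_def)
  have hp1: "(cmod (of_real (1 / u) - 1))\<^sup>2 = (1 - u)\<^sup>2 / u\<^sup>2"
  proof -
    have "of_real (1 / u) - 1 = complex_of_real ((1 - u) / u)"
      using \<open>0 < u\<close> by (simp add: field_simps)
    then show ?thesis
      by (simp only: norm_of_real power2_abs power_divide)
  qed
  have nf: "(norm (mvu_filter x /\<^sub>R u))\<^sup>2 = (1 / n) / u\<^sup>2"
    unfolding f using \<open>x \<noteq> 0\<close> by (simp add: n_def power2_eq_square divide_simps)
  define C where "C = (cmod h)\<^sup>2 + vw / n"
  have "0 < C"
    unfolding C_def using \<open>0 < vw\<close> \<open>0 < n\<close> by (simp add: add_nonneg_pos)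
  have den: "(cmod h)\<^sup>2 * (cmod (of_real (1 / u)))\<^sup>2 + vw * ((1 / n) / u\<^sup>2) = C / u\<^sup>2"
    by (simp add: C_def norm_divide power_divide add_divide_distrib)
  have num: "(cmod h)\<^sup>2 * ((1 - u)\<^sup>2 / u\<^sup>2) + vw * ((1 / n) / u\<^sup>2)
      = ((cmod h)\<^sup>2 * (1 - u)\<^sup>2 + vw / n) / u\<^sup>2"
    by (simp add: add_divide_distrib)
  show ?thesis
    unfolding zf_mse0_eq[OF assms(1,2)] hp hp1 nf den num n_def[symmetric] C_def[symmetric]
    using \<open>0 < u\<close> \<open>0 < C\<close> by (simp add: field_simps)
qed

theorem proposition1:
  fixes M :: "'a measure"
    and x_tr :: "complex ^ 'b"
    and w_tr :: "'a \<Rightarrow> complex ^ 'b"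
    and h :: complex
    and vx vw :: real
  assumes "prob_space M"
    and "x_tr \<noteq> 0"
    and "vx > 0"
    and "vw > 0"
    and "iid_circ_gaussian M vw w_tr"
  shows "\<not> is_arg_min (zf_mse0 M h x_tr w_tr vx vw) (\<lambda>f. f \<noteq> 0) (mvu_filter x_tr)"
proof -
  interpret prob_space M by fact
  define a where "a = (cmod h)\<^sup>2 * vx"
  \<comment> \<open>With \<open>u = 1 - e\<close>, the varying part of the numerator is
    \<open>a * e^2 + vw * (1 - e)^2\<close>, minimal at \<open>vw / (a + vw)\<close>. That point
    equals 1 when \<open>h = 0\<close>, where the scaling by \<open>1 / (1 - e)\<close> degenerates;
    the larger denominator keeps \<open>e\<close> at most 1/2 and still gives a decrease.\<close>
  define e where "e = vw / (a + 2 * vw)"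
  have "0 \<le> a"
    using \<open>vx > 0\<close> by (simp add: a_def)
  have e: "0 < e" "e < 1" "e * (a + 2 * vw) = vw"
    using \<open>0 \<le> a\<close> \<open>vw > 0\<close> by (simp_all add: e_def field_simps)
  define C where "C = (cmod h)\<^sup>2 + vw / (norm x_tr)\<^sup>2"
  have "0 < C"
    unfolding C_def using \<open>vw > 0\<close> \<open>x_tr \<noteq> 0\<close> by (simp add: add_nonneg_pos)
  \<comment> \<open>Compare with \<open>vw\<close>, the value at \<open>e = 0\<close>, which is the
    MVU filter.\<close>
  have "a * e\<^sup>2 + vw * (1 - e)\<^sup>2 = vw - e * (2 * vw - e * (a + vw))"
    by (simp add: power2_eq_square algebra_simps)
  moreover have "0 < e * (2 * vw - e * (a + vw))"
  proof (rule mult_pos_pos[OF e(1)])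
    have "e * (a + vw) \<le> e * (a + 2 * vw)"
      using e(1) \<open>vw > 0\<close> by simp
    then show "0 < 2 * vw - e * (a + vw)"
      using e(3) \<open>vw > 0\<close> by linarith
  qed
  ultimately have less: "a * e\<^sup>2 + vw * (1 - e)\<^sup>2 < vw"
    by linarith
  have "zf_mse0 M h x_tr w_tr vx vw (mvu_filter x_tr /\<^sub>R (1 - e))
      = (a * e\<^sup>2 + vw * (1 - e)\<^sup>2 + vw / (norm x_tr)\<^sup>2 * vx) / C"
    using zf_mse0_scaled_mvu_filter[OF assms(4,5,2), of "1 - e"] e(2)
    by (simp add: C_def a_def algebra_simps)
  also have "\<dots> < (vw + vw / (norm x_tr)\<^sup>2 * vx) / C"
    using less \<open>0 < C\<close> by (intro divide_strict_right_mono) auto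
  \<comment> \<open>The MVU filter itself is the point \<open>u = 1\<close> of the ray.\<close>
  also have "\<dots> = zf_mse0 M h x_tr w_tr vx vw (mvu_filter x_tr)"
    using zf_mse0_scaled_mvu_filter[OF assms(4,5,2), of 1] by (simp add: C_def algebra_simps)
  finally have "zf_mse0 M h x_tr w_tr vx vw (mvu_filter x_tr /\<^sub>R (1 - e))
      < zf_mse0 M h x_tr w_tr vx vw (mvu_filter x_tr)" .
  moreover have "mvu_filter x_tr /\<^sub>R (1 - e) \<noteq> 0"
    using e(2) \<open>x_tr \<noteq> 0\<close> by (simp add: mvu_filter_def)
  ultimately show ?thesis
    unfolding is_arg_min_def by blast
qed

end
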